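(* For all integers $m \ge 0$ and $n \ge 0$, $$P_{(2m+1)n} = \sum_{i=0}^m (-1)^{n(m+i)}\, 2^{3i}\, \frac{2m+1}{2i+1} \binom{m+i}{2i} P_{n}^{2i+1},$$ where $(P_n)_{n\ge 0}$ is the Pell sequence.
   Context: The Pell sequence $(P_n)_{n\ge 0}$ is defined by $P_0=0$, $P_1=1$ and $P_{n+2}=2P_{n+1}+P_n$ for $n\ge 0$. The identity is between rational numbers. *)

theory Defs
  imports Complex_Main
begin

fun pell :: "nat \<Rightarrow> nat" where
  "pell 0 = 0"
| "pell (Suc 0) = 1"
| "pell (Suc (Suc n)) = 2 * pell (Suc n) + pell n"

end

theory Submission
  imports Defs
begin

text \<open>
  The identity is Binet's formula applied to a polynomial identity. Let \<open>\<alpha> = 1 + \<surd>2\<close> and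
  \<open>\<beta> = 1 - \<surd>2\<close>, so that \<open>2 \<surd>2 P\<^sub>k = \<alpha>\<^sup>k - \<beta>\<^sup>k\<close>. With \<open>u = \<alpha>\<^sup>n\<close> and \<open>v = \<beta>\<^sup>n\<close> the left-hand
  side is \<open>u\<^sup>2\<^sup>m\<^sup>+\<^sup>1 - v\<^sup>2\<^sup>m\<^sup>+\<^sup>1\<close> and \<open>P\<^sub>n\<close> is \<open>u - v\<close>, both up to the factor \<open>2 \<surd>2\<close>, and
  \<open>uv = (-1)\<^sup>n\<close>. In any commutative ring \<open>u\<^sup>2\<^sup>m\<^sup>+\<^sup>1 - v\<^sup>2\<^sup>m\<^sup>+\<^sup>1\<close> is a polynomial in
  \<open>d = u - v\<close> and \<open>q = uv\<close>: as a sequence in \<open>m\<close> it satisfies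
  \<open>w\<^sub>m\<^sub>+\<^sub>2 = (u\<^sup>2 + v\<^sup>2) w\<^sub>m\<^sub>+\<^sub>1 - (uv)\<^sup>2 w\<^sub>m\<close> with \<open>u\<^sup>2 + v\<^sup>2 = d\<^sup>2 + 2q\<close>, and this recurrence determines
  the coefficient of \<open>q\<^sup>m\<^sup>-\<^sup>i d\<^sup>2\<^sup>i\<^sup>+\<^sup>1\<close> (lemma \<open>odd_power_diff_expansion\<close>). Substituting
  \<open>d = 2 \<surd>2 P\<^sub>n\<close> turns \<open>d\<^sup>2\<^sup>i\<^sup>+\<^sup>1\<close> into \<open>8\<^sup>i P\<^sub>n\<^sup>2\<^sup>i\<^sup>+\<^sup>1\<close> times the common factor \<open>2 \<surd>2\<close>, which cancels.
\<close>

text \<open>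
  This is \<open>(2m+1)/(2i+1) \<cdot> (m+i choose 2i)\<close>. Written without the quotient it is visibly a natural
  number, meaningful in every ring, it vanishes for \<open>i > m\<close>, and its recurrence
  follows from Pascal's rule alone.
\<close>
definition odd_power_coeff :: "nat \<Rightarrow> nat \<Rightarrow> nat" where
  "odd_power_coeff m i = ((m + i) choose (2 * i)) + 2 * ((m + i) choose (2 * i + 1))"

text \<open>
  The two forms agree because \<open>(2i+1) (m+i choose 2i+1) = (m-i) (m+i choose 2i)\<close>, and
  \<open>(2i+1) + 2(m-i) = 2m+1\<close>.
\<close>
lemma odd_power_coeff_eq:
  assumes "i \<le> m"
  shows "(of_nat (odd_power_coeff m i) :: 'a :: field_char_0) =
    of_nat (2 * m + 1) / of_nat (2 * i + 1) * of_nat ((m + i) choose (2 * i))"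
proof -
  have absorb: "(2 * i + 1) * ((m + i) choose (2 * i + 1)) = (m - i) * ((m + i) choose (2 * i))"
    using binomial_absorb_comp[of "m + i" "2 * i"] binomial_absorption[of "2 * i" "m + i"] assms
    by simp
  have "(2 * i + 1) * odd_power_coeff m i =
      (2 * i + 1) * ((m + i) choose (2 * i)) + 2 * ((m - i) * ((m + i) choose (2 * i)))"
    unfolding odd_power_coeff_def absorb[symmetric] by (simp only: algebra_simps)
  also have "\<dots> = ((2 * i + 1) + 2 * (m - i)) * ((m + i) choose (2 * i))"
    by (simp only: algebra_simps)
  also have "(2 * i + 1) + 2 * (m - i) = 2 * m + 1"
    using assms by simp
  finally have "of_nat (2 * i + 1) * (of_nat (odd_power_coeff m i) :: 'a) =
      of_nat (2 * m + 1) * of_nat ((m + i) choose (2 * i))"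
    by (metis of_nat_mult)
  moreover have "(of_nat (2 * i + 1) :: 'a) \<noteq> 0"
    by (simp only: of_nat_eq_0_iff)
  ultimately show ?thesis
    by (metis nonzero_mult_div_cancel_left times_divide_eq_left)
qed

lemma odd_power_coeff_eq_0: "m < i \<Longrightarrow> odd_power_coeff m i = 0"
  by (simp add: odd_power_coeff_def)

text \<open>
  Both binomial coefficients in the definition satisfy this recurrence by themselves: the second difference
  of \<open>n choose (k + 2)\<close> in \<open>n\<close> is \<open>n choose k\<close>.
\<close>
lemma odd_power_coeff_rec:
  "odd_power_coeff (m + 2) (Suc i) + odd_power_coeff m (Suc i) =
     2 * odd_power_coeff (m + 1) (Suc i) + odd_power_coeff (m + 1) i"
proof -
  have second_diff: "(Suc (Suc n) choose Suc (Suc k)) + (n choose Suc (Suc k)) =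
      2 * (Suc n choose Suc (Suc k)) + (n choose k)" for n k
    by simp
  show ?thesis
    using second_diff[of "m + i + 1" "2 * i"] second_diff[of "m + i + 1" "2 * i + 1"]
    unfolding odd_power_coeff_def by (simp del: binomial_Suc_Suc)
qed

lemma odd_power_diff_rec:
  fixes u v :: "'a :: comm_ring_1"
  shows "u ^ (2 * (m + 2) + 1) - v ^ (2 * (m + 2) + 1) =
    ((u - v)\<^sup>2 + 2 * (u * v)) * (u ^ (2 * (m + 1) + 1) - v ^ (2 * (m + 1) + 1))
      - (u * v)\<^sup>2 * (u ^ (2 * m + 1) - v ^ (2 * m + 1))"
  by (simp add: algebra_simps power2_eq_square)

text \<open>
  A Girard--Waring type expansion. Both sides agree for \<open>m = 0, 1\<close> and satisfy
  \<open>w\<^sub>m\<^sub>+\<^sub>2 = (d\<^sup>2 + 2q) w\<^sub>m\<^sub>+\<^sub>1 - q\<^sup>2 w\<^sub>m\<close> with \<open>d = u - v\<close> and \<open>q = uv\<close>.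
\<close>
lemma odd_power_diff_expansion:
  fixes u v :: "'a :: comm_ring_1"
  shows "u ^ (2 * m + 1) - v ^ (2 * m + 1) =
    (\<Sum>i\<le>m. of_nat (odd_power_coeff m i) * (u * v) ^ (m - i) * (u - v) ^ (2 * i + 1))"
proof -
  define d q where "d = u - v" and "q = u * v"
  define t where "t m i = of_nat (odd_power_coeff m i) * q ^ (m - i) * d ^ (2 * i + 1)" for m i
  have t_0: "t m i = 0" if "m < i" for m i
    using that by (simp add: t_def odd_power_coeff_eq_0)
  \<comment> \<open>The recurrence relates sums of lengths \<open>m\<close>, \<open>m + 1\<close> and \<open>m + 2\<close>; padding with zero terms
    brings them to a common range.\<close>
  have extend: "(\<Sum>i\<le>m. t m i) = (\<Sum>i\<le>N. t m i)" if "m \<le> N" for m N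
    by (rule sum.mono_neutral_left) (use that t_0 in auto)
  \<comment> \<open>Where the subtraction in \<open>q ^ (m - i)\<close> truncates, the coefficient vanishes, so powers of \<open>q\<close>
    can be moved in and out of a term for every \<open>i\<close>.\<close>
  have shift: "of_nat (odd_power_coeff m i) * q ^ (m + k - i) * d ^ (2 * i + 1) = q ^ k * t m i"
    for m k i
  proof (cases "i \<le> m")
    case True
    then have "m + k - i = k + (m - i)"
      by simp
    then show ?thesis
      by (simp add: t_def power_add ac_simps)
  qed (simp add: t_def odd_power_coeff_eq_0)
  have t_rec_0: "t (m + 2) 0 = 2 * q * t (m + 1) 0 - q\<^sup>2 * t m 0" for m
    by (simp add: t_def odd_power_coeff_def algebra_simps power2_eq_square)
  have t_rec: "t (m + 2) (Suc i) =
      2 * q * t (m + 1) (Suc i) + d\<^sup>2 * t (m + 1) i - q\<^sup>2 * t m (Suc i)" for m i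
  proof -
    let ?p = "q ^ (m + 2 - Suc i) * d ^ (2 * Suc i + 1)"
    have "t (m + 2) (Suc i) + of_nat (odd_power_coeff m (Suc i)) * ?p =
        of_nat (odd_power_coeff (m + 2) (Suc i) + odd_power_coeff m (Suc i)) * ?p"
      by (simp add: t_def distrib_right mult.assoc)
    also have "\<dots> = 2 * (of_nat (odd_power_coeff (m + 1) (Suc i)) * ?p) +
        of_nat (odd_power_coeff (m + 1) i) * ?p"
      unfolding odd_power_coeff_rec by (simp add: distrib_right mult.assoc)
    also have "of_nat (odd_power_coeff (m + 1) i) * ?p = d\<^sup>2 * t (m + 1) i"
      by (simp add: t_def power2_eq_square ac_simps)
    also have "of_nat (odd_power_coeff (m + 1) (Suc i)) * ?p = q * t (m + 1) (Suc i)"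
      using shift[of "m + 1" "Suc i" 1] by (simp add: mult.assoc)
    also have "of_nat (odd_power_coeff m (Suc i)) * ?p = q\<^sup>2 * t m (Suc i)"
      using shift[of m "Suc i" 2] by (simp add: mult.assoc)
    finally show ?thesis
      by (simp add: algebra_simps)
  qed
  have sum_rec: "(\<Sum>i\<le>m + 2. t (m + 2) i) =
      (d\<^sup>2 + 2 * q) * (\<Sum>i\<le>m + 1. t (m + 1) i) - q\<^sup>2 * (\<Sum>i\<le>m. t m i)" for m
  proof -
    have split: "(\<Sum>i\<le>m + 2. f i) = f 0 + (\<Sum>i\<le>m + 1. f (Suc i))" for f :: "nat \<Rightarrow> 'a"
      using sum.atMost_Suc_shift[of f "m + 1"] by simp
    have "(\<Sum>i\<le>m + 2. t (m + 2) i) =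
        2 * q * (\<Sum>i\<le>m + 2. t (m + 1) i) + d\<^sup>2 * (\<Sum>i\<le>m + 1. t (m + 1) i)
          - q\<^sup>2 * (\<Sum>i\<le>m + 2. t m i)"
      unfolding split t_rec_0 t_rec
      by (simp add: sum.distrib sum_subtractf sum_distrib_left algebra_simps del: sum.atMost_Suc)
    also have "(\<Sum>i\<le>m + 2. t (m + 1) i) = (\<Sum>i\<le>m + 1. t (m + 1) i)"
      by (rule extend[symmetric]) simp
    also have "(\<Sum>i\<le>m + 2. t m i) = (\<Sum>i\<le>m. t m i)"
      by (rule extend[symmetric]) simp
    finally show ?thesis
      by (simp add: algebra_simps)
  qed
  have "u ^ (2 * m + 1) - v ^ (2 * m + 1) = (\<Sum>i\<le>m. t m i)"
  proof (induction m rule: induct_nat_012)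
    case 0
    show ?case
      by (simp add: t_def odd_power_coeff_def d_def)
  next
    case 1
    show ?case
      by (simp add: t_def odd_power_coeff_def d_def q_def algebra_simps eval_nat_numeral)
  next
    case (ge2 m)
    show ?case
      using odd_power_diff_rec[of u m v] sum_rec[of m] ge2 by (simp add: d_def q_def)
  qed
  then show ?thesis
    by (simp add: t_def d_def q_def)
qed

lemma pell_binet:
  "2 * sqrt 2 * real (pell k) = (1 + sqrt 2) ^ k - (1 - sqrt 2) ^ k"
proof (induction k rule: pell.induct)
  case (3 k)
  have sq: "(1 + sqrt 2) ^ Suc (Suc k) = 2 * (1 + sqrt 2) ^ Suc k + (1 + sqrt 2) ^ k"
    "(1 - sqrt 2) ^ Suc (Suc k) = 2 * (1 - sqrt 2) ^ Suc k + (1 - sqrt 2) ^ k"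
    by (simp_all add: algebra_simps)
  show ?case
    using 3 unfolding sq by (simp add: algebra_simps)
qed simp_all

text \<open>
  Binet's formula makes this an instance of \<open>odd_power_diff_expansion\<close>. The sign exponent is \<open>m - i\<close> in the expansion and
  \<open>m + i\<close> here; the two have the same parity.
\<close>
lemma pell_odd_multiple:
  "int (pell ((2 * m + 1) * n)) =
    (\<Sum>i\<le>m. (- 1) ^ (n * (m + i)) * 8 ^ i * int (odd_power_coeff m i) * int (pell n) ^ (2 * i + 1))"
    (is "_ = ?S")
proof -
  define u v where "u = (1 + sqrt 2) ^ n" and "v = (1 - sqrt 2) ^ n"
  have uv: "u * v = (- 1) ^ n"
    unfolding u_def v_def power_mult_distrib[symmetric] by (simp add: algebra_simps)
  have diff: "u - v = 2 * sqrt 2 * real (pell n)"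
    by (simp add: u_def v_def pell_binet)
  have sgn: "(u * v) ^ (m - i) = (- 1) ^ (n * (m + i))" if "i \<le> m" for i
    unfolding uv power_mult[symmetric] using that
    by (simp add: minus_one_power_iff)
  have dpow: "(u - v) ^ (2 * i + 1) = 2 * sqrt 2 * (8 ^ i * real (pell n) ^ (2 * i + 1))" for i
    unfolding diff by (simp add: power_mult_distrib power_mult)
  have "2 * sqrt 2 * real (pell ((2 * m + 1) * n)) = u ^ (2 * m + 1) - v ^ (2 * m + 1)"
    unfolding pell_binet u_def v_def power_mult[symmetric] by (simp only: mult.commute)
  also have "\<dots> = (\<Sum>i\<le>m. real (odd_power_coeff m i) * (u * v) ^ (m - i) * (u - v) ^ (2 * i + 1))"
    by (rule odd_power_diff_expansion)
  also have "\<dots> = (\<Sum>i\<le>m. 2 * sqrt 2 * ((- 1) ^ (n * (m + i)) * 8 ^ i *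
      real (odd_power_coeff m i) * real (pell n) ^ (2 * i + 1)))"
    unfolding dpow by (rule sum.cong) (simp_all add: sgn)
  also have "\<dots> = 2 * sqrt 2 * real_of_int ?S"
    by (simp add: sum_distrib_left)
  finally have "real_of_int (int (pell ((2 * m + 1) * n))) = of_int ?S"
    by simp
  then show ?thesis
    by (simp only: of_int_eq_iff)
qed

theorem theorem1:
  fixes m n :: nat
  shows "(of_nat (pell ((2 * m + 1) * n)) :: rat) =
    (\<Sum>i = 0..m. (- 1) ^ (n * (m + i)) * 2 ^ (3 * i) *
       (of_nat (2 * m + 1) / of_nat (2 * i + 1)) *
       of_nat ((m + i) choose (2 * i)) * of_nat (pell n) ^ (2 * i + 1))"
proof -
  have "(of_nat (pell ((2 * m + 1) * n)) :: rat) = of_int (int (pell ((2 * m + 1) * n)))"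
    by (rule of_int_of_nat_eq[symmetric])
  also have "\<dots> = (\<Sum>i = 0..m. (- 1) ^ (n * (m + i)) * 8 ^ i * of_nat (odd_power_coeff m i) *
      of_nat (pell n) ^ (2 * i + 1))"
    unfolding pell_odd_multiple by (simp add: atMost_atLeast0)
  also have "\<dots> = (\<Sum>i = 0..m. (- 1) ^ (n * (m + i)) * 2 ^ (3 * i) *
       (of_nat (2 * m + 1) / of_nat (2 * i + 1)) *
       of_nat ((m + i) choose (2 * i)) * of_nat (pell n) ^ (2 * i + 1))"
    by (rule sum.cong) (simp_all add: odd_power_coeff_eq power_mult del: of_nat_Suc of_nat_add of_nat_mult)
  finally show ?thesis .
qed

end
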